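(* Let $\theta\ge 0$ be an admissible exponent towards the Ramanujan conjecture (defined in the context). For $X\ge 1$ and a non-zero integer $r$ let \[ \mathcal{S}_r(X)=\#\{(a,b,c,d)\in\mathbb{Z}^4:\ ad-bc=r,\ |a|,|b|,|c|,|d|\le X\}. \] Then for every $\varepsilon>0$, \[ \mathcal{S}_r(X)=\frac{16}{\zeta(2)}\frac{\sigma(|r|)}{|r|}X^2+O_{\varepsilon}\big(|r|^{\theta}X^{3/2+\varepsilon}\big), \] as long as $r=O(X^{1/3})$ (the implied constant in the error term depending on $\varepsilon$ and on the implied constant in $r=O(X^{1/3})$).
   Context: $\sigma(n)$ is the sum of the positive divisors of the positive integer $n$, and $\zeta$ is the Riemann zeta function. Admissible exponent: let $\{u_j\}_{j\ge1}$ be an orthonormal basis of Maass cusp forms for $SL(2,\mathbb{Z})$ consisting of joint eigenfunctions of all Hecke operators $T_n$, and let $\lambda_j(n)$ be the eigenvalue of $u_j$ under $T_n$. A real number $\theta\ge0$ is called admissible if $|\lambda_j(p)|\le 2p^{\theta}$ for every $j$ and every prime $p$ (by Kim–Sarnak, $\theta=7/64$ is admissible; conjecturally any $\theta>0$ is). *)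

theory Defs
  imports "HOL-Analysis.Analysis" "HOL-Computational_Algebra.Primes"
begin

subsection \<open>Arithmetic functions and the counting function\<close>

definition divisor_sum :: "nat \<Rightarrow> nat" where
  "divisor_sum n = (\<Sum>d | d dvd n. d)"

text \<open>The Dirichlet series of the Riemann zeta function; meaningful for real \<open>s > 1\<close> only.\<close>

definition zeta :: "real \<Rightarrow> real" where
  "zeta s = (\<Sum>n. 1 / real (Suc n) powr s)"

definition det_count :: "int \<Rightarrow> real \<Rightarrow> nat" where
  "det_count r X = card {(a::int, b::int, c::int, d::int).
      a * d - b * c = r \<and>
      real_of_int \<bar>a\<bar> \<le> X \<and> real_of_int \<bar>b\<bar> \<le> X \<and>
      real_of_int \<bar>c\<bar> \<le> X \<and> real_of_int \<bar>d\<bar> \<le> X}"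


subsection \<open>The modular surface\<close>

text \<open>Functions on the upper half plane are represented by functions on all of \<open>complex\<close>;
  their values outside \<open>upper_half_plane\<close> are irrelevant to everything below.\<close>

definition upper_half_plane :: "complex set" where
  "upper_half_plane = {z. Im z > 0}"

definition modular_invariant :: "(complex \<Rightarrow> complex) \<Rightarrow> bool" where
  "modular_invariant f \<longleftrightarrow>
     (\<forall>a b c d :: int. a * d - b * c = 1 \<longrightarrow>
       (\<forall>z\<in>upper_half_plane.
          f ((of_int a * z + of_int b) / (of_int c * z + of_int d)) = f z))"

text \<open>The standard fundamental domain, with its boundary (a null set) included.\<close>

definition fundamental_domain :: "complex set" where
  "fundamental_domain = {z. Im z > 0 \<and> \<bar>Re z\<bar> \<le> 1/2 \<and> cmod z \<ge> 1}"

definition hyperbolic_measure :: "complex measure" where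
  "hyperbolic_measure =
     density lborel (\<lambda>z. ennreal (indicator upper_half_plane z / (Im z)\<^sup>2))"

definition petersson :: "(complex \<Rightarrow> complex) \<Rightarrow> (complex \<Rightarrow> complex) \<Rightarrow> complex" where
  "petersson f g = (LINT z:fundamental_domain|hyperbolic_measure. f z * cnj (g z))"

definition square_integrable :: "(complex \<Rightarrow> complex) \<Rightarrow> bool" where
  "square_integrable f \<longleftrightarrow>
     set_integrable hyperbolic_measure fundamental_domain (\<lambda>z. (cmod (f z))\<^sup>2)"

text \<open>The zeroth Fourier coefficient at the cusp, as a function of the height \<open>y\<close>.\<close>

definition constant_term :: "(complex \<Rightarrow> complex) \<Rightarrow> real \<Rightarrow> complex" where
  "constant_term f y = (LINT x:{0..1}|lborel. f (Complex x y))"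


subsection \<open>Maass cusp forms for the full modular group\<close>

definition dx :: "(complex \<Rightarrow> complex) \<Rightarrow> complex \<Rightarrow> complex" where
  "dx f z = vector_derivative (\<lambda>t::real. f (z + of_real t)) (at 0)"

definition dy :: "(complex \<Rightarrow> complex) \<Rightarrow> complex \<Rightarrow> complex" where
  "dy f z = vector_derivative (\<lambda>t::real. f (z + \<i> * of_real t)) (at 0)"

text \<open>\<open>C_diff k f\<close>: all real partial derivatives of \<open>f\<close> up to order \<open>k\<close> exist and are
  continuous on the upper half plane.\<close>

primrec C_diff :: "nat \<Rightarrow> (complex \<Rightarrow> complex) \<Rightarrow> bool" where
  "C_diff 0 f \<longleftrightarrow> continuous_on upper_half_plane f"
| "C_diff (Suc k) f \<longleftrightarrow>
     continuous_on upper_half_plane f \<and>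
     (\<forall>z\<in>upper_half_plane.
        (\<lambda>t::real. f (z + of_real t)) differentiable (at 0) \<and>
        (\<lambda>t::real. f (z + \<i> * of_real t)) differentiable (at 0)) \<and>
     C_diff k (dx f) \<and> C_diff k (dy f)"

definition laplacian :: "(complex \<Rightarrow> complex) \<Rightarrow> complex \<Rightarrow> complex" where
  "laplacian f z = - of_real ((Im z)\<^sup>2) * (dx (dx f) z + dy (dy f) z)"

definition maass_cusp_form :: "(complex \<Rightarrow> complex) \<Rightarrow> bool" where
  "maass_cusp_form f \<longleftrightarrow>
     (\<forall>k. C_diff k f) \<and>
     modular_invariant f \<and>
     (\<exists>ev. \<forall>z\<in>upper_half_plane. laplacian f z = ev * f z) \<and>
     square_integrable f \<and>
     (\<forall>y>0. constant_term f y = 0)"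

text \<open>The Hilbert space of cuspidal functions in \<open>L\<^sup>2\<close> of the modular surface
  (as functions, not as classes modulo null sets).\<close>

definition L2_cusp :: "(complex \<Rightarrow> complex) set" where
  "L2_cusp = {f. set_borel_measurable lborel upper_half_plane f \<and>
     modular_invariant f \<and> square_integrable f \<and>
     (AE y in lborel. y > 0 \<longrightarrow> constant_term f y = 0)}"


subsection \<open>Hecke operators and admissible exponents\<close>

text \<open>The normalisation by \<open>1 / sqrt n\<close> is the one for which the Ramanujan conjecture reads
  \<open>\<bar>\<lambda>\<^sub>j(p)\<bar> \<le> 2\<close>.\<close>

definition hecke :: "nat \<Rightarrow> (complex \<Rightarrow> complex) \<Rightarrow> complex \<Rightarrow> complex" where
  "hecke n f z = (1 / of_real (sqrt (real n))) *
     (\<Sum>(a, d) | a * d = n. \<Sum>b<d. f ((of_nat a * z + of_nat b) / of_nat d))"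

definition is_hecke_eigenvalue :: "nat \<Rightarrow> (complex \<Rightarrow> complex) \<Rightarrow> complex \<Rightarrow> bool" where
  "is_hecke_eigenvalue n f l \<longleftrightarrow> (\<forall>z\<in>upper_half_plane. hecke n f z = l * f z)"

definition hecke_eigenvalue :: "nat \<Rightarrow> (complex \<Rightarrow> complex) \<Rightarrow> complex" where
  "hecke_eigenvalue n f = (THE l. is_hecke_eigenvalue n f l)"

text \<open>The sequence is indexed by \<open>j \<ge> 1\<close>; \<open>u 0\<close> is unused.  The last clause is convergence in
  norm of the expansion of every element of the Hilbert space.\<close>

definition hecke_maass_basis :: "(nat \<Rightarrow> complex \<Rightarrow> complex) \<Rightarrow> bool" where
  "hecke_maass_basis u \<longleftrightarrow>
     (\<forall>j\<ge>1. maass_cusp_form (u j)) \<and>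
     (\<forall>j\<ge>1. \<forall>n\<ge>1. \<exists>l. is_hecke_eigenvalue n (u j) l) \<and>
     (\<forall>i\<ge>1. \<forall>j\<ge>1. petersson (u i) (u j) = (if i = j then 1 else 0)) \<and>
     (\<forall>f\<in>L2_cusp.
        (\<lambda>N. LINT z:fundamental_domain|hyperbolic_measure.
               (cmod (f z - (\<Sum>j=1..N. petersson f (u j) * u j z)))\<^sup>2) \<longlonglongrightarrow> 0)"

definition admissible :: "(nat \<Rightarrow> complex \<Rightarrow> complex) \<Rightarrow> real \<Rightarrow> bool" where
  "admissible u \<theta> \<longleftrightarrow> \<theta> \<ge> 0 \<and>
     (\<forall>j\<ge>1. \<forall>p::nat. prime p \<longrightarrow> cmod (hecke_eigenvalue p (u j)) \<le> 2 * real p powr \<theta>)"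

end

theory Submission
  imports Defs "HOL-Number_Theory.Totient" "HOL-Computational_Algebra.Squarefree"
begin

text \<open>
  The bound holds with \<open>\<theta> = 0\<close> by an elementary argument, with error \<open>O(X\<^bsup>4/3\<^esup> log X)\<close>.
  Sort the matrices by the maximum \<open>m\<close> of the absolute values of their entries.  If \<open>m > \<bar>r\<bar>\<close>,
  exactly one entry has absolute value \<open>m\<close>: two such entries in one row or column would force
  \<open>m dvd r\<close>, and two on one diagonal are excluded by size.  If this entry is \<open>c\<close>, the only
  condition on \<open>a\<close> and \<open>d\<close> is \<open>a * d \<equiv> r\<close> modulo \<open>m\<close>: it determines \<open>b\<close>, and \<open>\<bar>b\<bar> < m\<close> is
  automatic.  Here \<open>a\<close> and \<open>d\<close> each run twice through the nonzero residues modulo \<open>m\<close>.  Hence there are exactly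
  \<open>4 * 2 * 4 * N(m)\<close> such matrices, where \<open>N(m)\<close> counts the solutions of \<open>x * y \<equiv> r\<close> modulo
  \<open>m\<close>.  The matrices with \<open>m \<le> \<bar>r\<bar>\<close> contribute only \<open>O(\<bar>r\<bar>\<^sup>3) = O(X)\<close>.  Finally \<open>N(m)\<close> is the sum
  of \<open>g * totient (m div g)\<close> over the common divisors \<open>g\<close> of \<open>m\<close> and \<open>r\<close>, so summing over \<open>m\<close>
  reduces the count to the mean value of the totient function.
\<close>

subsection \<open>The Moebius function and the mean value of the totient function\<close>

definition mobius :: "nat \<Rightarrow> real" where
  "mobius n = (if squarefree n then (- 1) ^ card (prime_factors n) else 0)"

lemma abs_mobius_le_1: "\<bar>mobius n\<bar> \<le> 1"
  by (simp add: mobius_def power_abs)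

lemma mobius_prime_mult:
  assumes "prime p" "\<not> p dvd d"
  shows "mobius (p * d) = - mobius d"
proof -
  have cop: "coprime p d"
    using assms by (simp add: prime_imp_coprime)
  have d: "d \<noteq> 0"
    using assms by (auto intro: ccontr)
  have "prime_factors (p * d) = insert p (prime_factors d)"
    using assms d by (auto simp: prime_factors_dvd prime_dvd_mult_iff dest: primes_dvd_imp_eq)
  moreover have "p \<notin> prime_factors d"
    using assms by (auto simp: prime_factors_dvd)
  moreover have "squarefree (p * d) \<longleftrightarrow> squarefree d"
    using cop assms squarefree_mult_coprime squarefree_prime squarefree_mono
    by (metis dvd_triv_right)
  ultimately show ?thesis
    by (simp add: mobius_def)
qed

text \<open>Fix a prime p dividing n. Inserting or removing the factor p is an involution on the
  squarefree divisors of n that flips the sign of \<open>mobius\<close>, so their sum equals its own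
  negative; the other divisors contribute 0.\<close>

lemma sum_mobius_divisors:
  assumes "n > 0"
  shows "(\<Sum>d | d dvd n. mobius d) = (if n = 1 then 1 else 0)"
proof (cases "n = 1")
  case True
  then show ?thesis by (simp add: mobius_def)
next
  case False
  then obtain p where p: "prime p" "p dvd n"
    using prime_factor_nat by blast
  define D where "D = {d. d dvd n \<and> squarefree d}"
  define f where "f d = (if p dvd d then d div p else p * d)" for d
  have fin: "finite {d. d dvd n}" using assms by simp
  have p0: "p > 0" using p(1) prime_gt_0_nat by blast
  have *: "f d \<in> D \<and> f (f d) = d \<and> mobius (f d) = - mobius d" if "d \<in> D" for d
  proof (cases "p dvd d")
    case True
    then obtain e where e: "d = p * e" by auto
    have "\<not> p dvd e"
    proof
      assume "p dvd e"
      then have "p ^ 2 dvd d" by (auto simp: e power2_eq_square)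
      then have "is_unit p" using that by (auto simp: D_def squarefree_def)
      then show False using p(1) not_prime_unit by blast
    qed
    moreover have "e \<in> D" using that squarefree_mono[of e d]
      by (auto simp: D_def e dest: dvd_mult_right)
    ultimately show ?thesis
      using p0 mobius_prime_mult[OF p(1), of e] by (simp add: f_def e)
  next
    case False
    have "coprime p d" using p(1) False by (simp add: prime_imp_coprime)
    then have "p * d dvd n" using that p(2) by (auto simp: D_def divides_mult)
    moreover have "squarefree (p * d)"
      using \<open>coprime p d\<close> that p(1) by (auto simp: D_def intro: squarefree_mult_coprime squarefree_prime)
    ultimately show ?thesis
      using p0 False mobius_prime_mult[OF p(1) False] by (simp add: f_def D_def)
  qed
  have "(\<Sum>d\<in>D. mobius d) = (\<Sum>d\<in>D. - mobius d)"
    by (rule sum.reindex_bij_witness[where i = f and j = f]) (use * in auto)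
  then have "(\<Sum>d\<in>D. mobius d) = 0" by (simp add: sum_negf)
  moreover have "(\<Sum>d\<in>D. mobius d) = (\<Sum>d | d dvd n. mobius d)"
    by (rule sum.mono_neutral_left) (use fin in \<open>auto simp: D_def mobius_def\<close>)
  ultimately show ?thesis using False by simp
qed

text \<open>The substitution n = d * k turns the pairs d dvd n \<le> m into the lattice points with
  d * k \<le> m.\<close>

lemma sum_divisors_swap:
  fixes f :: "nat \<Rightarrow> nat \<Rightarrow> real"
  shows "(\<Sum>n=1..m. \<Sum>d | d dvd n. f d (n div d)) = (\<Sum>d=1..m. \<Sum>k=1..m div d. f d k)"
proof -
  have "(\<Sum>n=1..m. \<Sum>d | d dvd n. f d (n div d)) =
        (\<Sum>(n, d)\<in>Sigma {1..m} (\<lambda>n. {d. d dvd n}). f d (n div d))"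
    by (rule sum.Sigma) auto
  also have "\<dots> = (\<Sum>(d, k)\<in>Sigma {1..m} (\<lambda>d. {1..m div d}). f d k)"
    by (rule sum.reindex_bij_witness[where i = "\<lambda>(d, k). (d * k, d)" and j = "\<lambda>(n, d). (d, n div d)"])
       (auto simp: div_le_mono Suc_le_eq div_greater_zero_iff dvd_imp_le
             intro: dvd_pos_nat order_trans[OF dvd_imp_le] order_trans[OF mult_le_mono2 times_div_less_eq_dividend])
  also have "\<dots> = (\<Sum>d=1..m. \<Sum>k=1..m div d. f d k)"
    by (rule sum.Sigma[symmetric]) auto
  finally show ?thesis .
qed

text \<open>The coprimality indicator is replaced by the Moebius sum over the divisors of the gcd.
  After exchanging the sums, each d dvd n is weighted by the number of its multiples up to
  n.\<close>

lemma totient_eq_sum_mobius: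
  assumes "n > 0"
  shows "real (totient n) = (\<Sum>d | d dvd n. mobius d * real (n div d))"
proof -
  have fin: "finite {d. d dvd n}" using assms by simp
  have "real (totient n) = (\<Sum>k\<in>{0<..n}. if gcd k n = 1 then 1 else 0)"
    by (simp add: totient_def totatives_def coprime_iff_gcd_eq_1 sum.If_cases Int_def)
  also have "\<dots> = (\<Sum>k\<in>{0<..n}. \<Sum>d | d dvd gcd k n. mobius d)"
    using assms by (intro sum.cong refl sum_mobius_divisors[symmetric]) simp
  also have "\<dots> = (\<Sum>k\<in>{0<..n}. \<Sum>d | d dvd n \<and> d dvd k. mobius d)"
    by (intro sum.cong refl) auto
  also have "\<dots> = (\<Sum>d | d dvd n. \<Sum>k | k \<in> {0<..n} \<and> d dvd k. mobius d)"
    using sum.swap_restrict[of "{0<..n}" "{d. d dvd n}" "\<lambda>k d. mobius d" "\<lambda>k d. d dvd k"] fin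
    by simp
  also have "\<dots> = (\<Sum>d | d dvd n. mobius d * real (n div d))"
  proof (intro sum.cong refl)
    fix d assume d: "d \<in> {d. d dvd n}"
    then have "d > 0" using assms by (auto intro: dvd_pos_nat)
    have "bij_betw ((*) d) {0<..n div d} {k. k \<in> {0<..n} \<and> d dvd k}"
      by (rule bij_betw_byWitness[where f' = "\<lambda>k. k div d"])
         (use \<open>d > 0\<close> in \<open>auto simp: div_le_mono less_eq_div_iff_mult_less_eq mult.commute
             dest: dvd_imp_le elim!: dvdE\<close>)
    then have "card {k. k \<in> {0<..n} \<and> d dvd k} = n div d"
      by (metis bij_betw_same_card card_greaterThanAtMost diff_zero)
    then show "(\<Sum>k | k \<in> {0<..n} \<and> d dvd k. mobius d) = mobius d * real (n div d)"
      by simp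
  qed
  finally show ?thesis .
qed

section \<open>Partial sums of the series for zeta(2)\<close>

lemma sum_inverse_squares_telescope:
  assumes "q > 0"
  shows "(\<Sum>k=Suc q..q + j. 1 / (real k)\<^sup>2) \<le> 1 / real q - 1 / real (q + j)"
proof (induction j)
  case (Suc j)
  \<comment> \<open>Each term 1 / k^2 is bounded by 1 / ((k - 1) * k), which telescopes.\<close>
  have "1 / (real (q + Suc j))\<^sup>2 \<le> 1 / (real (q + j) * real (q + Suc j))"
    using assms by (intro divide_left_mono) (auto simp: power2_eq_square)
  also have "\<dots> = 1 / real (q + j) - 1 / real (q + Suc j)"
    using assms by (simp add: field_simps)
  finally show ?case using Suc.IH by simp
qed simp

lemma zeta_2_sums: "(\<lambda>n. 1 / (real (Suc n))\<^sup>2) sums zeta 2"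
proof -
  have "summable (\<lambda>n. 1 / (real (Suc n))\<^sup>2)"
    using inverse_power_summable[of 2, where 'a = real] summable_Suc_iff[of "\<lambda>n. inverse (real n ^ 2)"]
    by (simp add: inverse_eq_divide)
  then show ?thesis
    by (simp add: zeta_def powr_numeral summable_sums)
qed

text \<open>The partial sums increase, and the telescoping bound on the part beyond q is uniform in
  the upper limit; both inequalities pass to the limit.\<close>

lemma zeta_2_minus_partial_sum:
  assumes "q > 0"
  shows "\<bar>zeta 2 - (\<Sum>k=1..q. 1 / (real k)\<^sup>2)\<bar> \<le> 1 / real q"
proof -
  define s where "s n = (\<Sum>k=1..n. 1 / (real k)\<^sup>2)" for n
  have "s = (\<lambda>n. \<Sum>k<n. 1 / (real (Suc k))\<^sup>2)"
    by (simp add: s_def fun_eq_iff sum.atLeast1_atMost_eq)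
  then have lim: "s \<longlonglongrightarrow> zeta 2"
    using zeta_2_sums by (simp add: sums_def)
  have split: "s (q + j) = s q + (\<Sum>k=Suc q..q + j. 1 / (real k)\<^sup>2)" for j
    unfolding s_def using sum.ub_add_nat[of 1 q "\<lambda>k. 1 / (real k)\<^sup>2" j] by simp
  have "s q \<le> s n" if "n \<ge> q" for n
    using split[of "n - q"] that by (simp add: sum_nonneg)
  then have "s q \<le> zeta 2"
    by (intro tendsto_lowerbound[OF lim]) (auto simp: eventually_sequentially)
  moreover have "s n \<le> s q + 1 / real q" if "n \<ge> q" for n
  proof -
    have "(\<Sum>k=Suc q..n. 1 / (real k)\<^sup>2) \<le> 1 / real q - 1 / real n"
      using sum_inverse_squares_telescope[OF assms, of "n - q"] that by simp
    moreover have "1 / real n \<ge> 0" by simp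
    ultimately show ?thesis using split[of "n - q"] that by (simp only: le_add_diff_inverse)
  qed
  then have "zeta 2 \<le> s q + 1 / real q"
    by (intro tendsto_upperbound[OF lim]) (auto simp: eventually_sequentially)
  ultimately show ?thesis by (simp add: s_def)
qed

lemma zeta_2_ge_1: "zeta 2 \<ge> 1"
proof -
  have "(\<Sum>n<1. 1 / (real (Suc n))\<^sup>2) \<le> zeta 2"
    unfolding sums_unique[OF zeta_2_sums] by (rule sum_le_suminf[OF sums_summable[OF zeta_2_sums]]) auto
  then show ?thesis by simp
qed

lemma real_div_bounds:
  assumes "d > 0"
  shows "real (m div d) \<le> real m / real d" "real m / real d < real (m div d) + 1"
proof -
  show "real (m div d) \<le> real m / real d" by (rule of_nat_div_le_of_nat)
  have "m < (m div d + 1) * d" using assms dividend_less_div_times[of d m] by simp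
  then have "real m < (real (m div d) + 1) * real d"
    by (metis of_nat_1 of_nat_add of_nat_less_iff of_nat_mult)
  then show "real m / real d < real (m div d) + 1" using assms by (simp add: pos_divide_less_eq)
qed

text \<open>Summing \<open>(\<Sum>d | d dvd n. mobius d) / n\<^sup>2\<close> over \<open>n \<le> m\<close> gives exactly \<open>1\<close>; no infinite
  Dirichlet product is needed.\<close>

lemma sum_mobius_squares_approx:
  assumes "m > 0"
  shows "\<bar>(\<Sum>d=1..m. mobius d / (real d)\<^sup>2) - 1 / zeta 2\<bar> \<le> 2 * harm m / real m"
proof -
  define P where "P = (\<Sum>d=1..m. mobius d / (real d)\<^sup>2)"
  have "1 = (\<Sum>n=1..m. (if n = 1 then 1 else 0) / (real n)\<^sup>2)"
    using assms by (simp add: if_distrib[of "\<lambda>x. x / _"] sum.delta cong: if_cong)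
  also have "\<dots> = (\<Sum>n=1..m. \<Sum>d | d dvd n. mobius d / (real d)\<^sup>2 * (1 / (real (n div d))\<^sup>2))"
  proof (intro sum.cong refl)
    fix n assume "n \<in> {1..m}"
    then have n: "n > 0" by simp
    have "(if n = 1 then 1 else 0) / (real n)\<^sup>2 = (\<Sum>d | d dvd n. mobius d / (real n)\<^sup>2)"
      using n by (simp only: sum_mobius_divisors sum_divide_distrib[symmetric])
    also have "\<dots> = (\<Sum>d | d dvd n. mobius d / (real d)\<^sup>2 * (1 / (real (n div d))\<^sup>2))"
    proof (intro sum.cong refl)
      fix d assume "d \<in> {d. d dvd n}"
      then have "real n = real d * real (n div d)" by (metis dvd_mult_div_cancel mem_Collect_eq of_nat_mult)
      then show "mobius d / (real n)\<^sup>2 = mobius d / (real d)\<^sup>2 * (1 / (real (n div d))\<^sup>2)"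
        by (simp add: power_mult_distrib)
    qed
    finally show "(if n = 1 then 1 else 0) / (real n)\<^sup>2 =
        (\<Sum>d | d dvd n. mobius d / (real d)\<^sup>2 * (1 / (real (n div d))\<^sup>2))" .
  qed
  also have "\<dots> = (\<Sum>d=1..m. mobius d / (real d)\<^sup>2 * (\<Sum>k=1..m div d. 1 / (real k)\<^sup>2))"
    by (subst sum_divisors_swap[of "\<lambda>d k. mobius d / (real d)\<^sup>2 * (1 / (real k)\<^sup>2)"])
       (simp only: sum_distrib_left)
  finally have one: "1 = (\<Sum>d=1..m. mobius d / (real d)\<^sup>2 * (\<Sum>k=1..m div d. 1 / (real k)\<^sup>2))" .
  \<comment> \<open>Subtracting the identity \<open>one\<close> leaves only the tails of the inner
    sums, weighted by mobius d / d^2.\<close>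
  have "zeta 2 * P - 1 =
      (\<Sum>d=1..m. mobius d / (real d)\<^sup>2 * (zeta 2 - (\<Sum>k=1..m div d. 1 / (real k)\<^sup>2)))"
    by (subst one) (simp add: P_def sum_distrib_left sum_subtractf algebra_simps)
  also have "\<bar>\<dots>\<bar> \<le> (\<Sum>d=1..m. 2 / real m * inverse (real d))"
  proof (rule order_trans[OF sum_abs sum_mono])
    fix d assume "d \<in> {1..m}"
    then have d: "d > 0" "d \<le> m" by auto
    then have q: "m div d > 0" by (simp add: div_greater_zero_iff)
    \<comment> \<open>As m div d is at least 1, rounding down loses at most a factor 2; this is the
      2 in the final bound.\<close>
    have "real m / real d < real (m div d) + 1" by (rule real_div_bounds[OF d(1)])
    also have "\<dots> \<le> 2 * real (m div d)" using q by simp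
    finally have "1 / real (m div d) \<le> 2 * real d / real m"
      using q d by (simp add: field_simps)
    then have "\<bar>zeta 2 - (\<Sum>k=1..m div d. 1 / (real k)\<^sup>2)\<bar> \<le> 2 * real d / real m"
      using zeta_2_minus_partial_sum[OF q] by linarith
    moreover have "\<bar>mobius d / (real d)\<^sup>2\<bar> \<le> 1 / (real d)\<^sup>2"
      using abs_mobius_le_1[of d] by (simp add: divide_right_mono)
    ultimately have "\<bar>mobius d / (real d)\<^sup>2 * (zeta 2 - (\<Sum>k=1..m div d. 1 / (real k)\<^sup>2))\<bar>
        \<le> 1 / (real d)\<^sup>2 * (2 * real d / real m)"
      unfolding abs_mult by (intro mult_mono) auto
    also have "\<dots> = 2 / real m * inverse (real d)"
      using d by (simp add: field_simps power2_eq_square)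
    finally show "\<bar>mobius d / (real d)\<^sup>2 * (zeta 2 - (\<Sum>k=1..m div d. 1 / (real k)\<^sup>2))\<bar>
        \<le> 2 / real m * inverse (real d)" .
  qed
  also have "\<dots> = 2 * harm m / real m"
    unfolding harm_def sum_distrib_left[symmetric] by simp
  finally have *: "\<bar>zeta 2 * P - 1\<bar> \<le> 2 * harm m / real m" .
  \<comment> \<open>Dividing by \<open>zeta 2\<close> does not enlarge the error because
    \<open>zeta 2\<close> is at least 1.\<close>
  have "\<bar>P - 1 / zeta 2\<bar> \<le> zeta 2 * \<bar>P - 1 / zeta 2\<bar>"
    using zeta_2_ge_1 mult_right_mono[of 1 "zeta 2" "\<bar>P - 1 / zeta 2\<bar>"] by simp
  also have "\<dots> = \<bar>zeta 2 * P - 1\<bar>"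
  proof -
    have "zeta 2 * P - 1 = zeta 2 * (P - 1 / zeta 2)"
      using zeta_2_ge_1 by (simp add: algebra_simps)
    then show ?thesis using zeta_2_ge_1 by (simp add: abs_mult)
  qed
  finally show ?thesis using * by (simp add: P_def)
qed

text \<open>Moebius inversion reduces the sum to triangular numbers q * (q + 1) / 2 with q = m div
  d. Replacing these by (m / d)^2 / 2, and then the truncated Moebius series by 1 / zeta(2), costs m
  * harm m each.\<close>

lemma sum_totient_approx:
  "\<bar>(\<Sum>k=1..m. real (totient k)) - (real m)\<^sup>2 / (2 * zeta 2)\<bar> \<le> 2 * real m * harm m"
proof (cases "m = 0")
  case False
  then have m: "m > 0" by simp
  define P where "P = (\<Sum>d=1..m. mobius d / (real d)\<^sup>2)"
  define q where "q d = real (m div d)" for d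
  have tri: "(\<Sum>k=1..j. real k) = real j * (real j + 1) / 2" for j
    by (induction j) (auto simp: field_simps)
  have "(\<Sum>k=1..m. real (totient k)) = (\<Sum>n=1..m. \<Sum>d | d dvd n. mobius d * real (n div d))"
    by (intro sum.cong refl totient_eq_sum_mobius) auto
  also have "\<dots> = (\<Sum>d=1..m. mobius d * (q d * (q d + 1) / 2))"
    by (subst sum_divisors_swap[of "\<lambda>d k. mobius d * real k"])
       (simp only: sum_distrib_left[symmetric] tri q_def)
  finally have "(\<Sum>k=1..m. real (totient k)) - (real m)\<^sup>2 / 2 * P =
      (\<Sum>d=1..m. mobius d * (q d * (q d + 1) / 2 - (real m / real d)\<^sup>2 / 2))"
    by (simp add: P_def sum_distrib_left sum_subtractf algebra_simps power_divide)
  also have "\<bar>\<dots>\<bar> \<le> (\<Sum>d=1..m. real m * inverse (real d))"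
  proof (rule order_trans[OF sum_abs sum_mono])
    fix d assume "d \<in> {1..m}"
    then have d: "d > 0" "d \<le> m" by auto
    define y where "y = real m / real d"
    have "m div d > 0" using d by (simp add: div_greater_zero_iff)
    then have q: "q d \<ge> 1" "q d \<le> y" "y \<le> q d + 1"
      using real_div_bounds[OF d(1), of m] by (auto simp: q_def y_def)
    have "(q d)\<^sup>2 \<le> y\<^sup>2" "y\<^sup>2 \<le> (q d + 1)\<^sup>2"
      using q by (auto intro!: power_mono)
    \<comment> \<open>The difference lies between -(q + 1) / 2 and q / 2, and (q + 1) / 2 \<le> q
      \<le> y because q \<ge> 1.\<close>
    then have "\<bar>q d * (q d + 1) / 2 - y\<^sup>2 / 2\<bar> \<le> y"
      using q unfolding abs_le_iff power2_eq_square by (simp add: field_simps)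
    then have "\<bar>mobius d * (q d * (q d + 1) / 2 - y\<^sup>2 / 2)\<bar> \<le> 1 * y"
      unfolding abs_mult by (intro mult_mono abs_mobius_le_1) auto
    then show "\<bar>mobius d * (q d * (q d + 1) / 2 - (real m / real d)\<^sup>2 / 2)\<bar> \<le> real m * inverse (real d)"
      by (simp add: y_def field_simps)
  qed
  also have "\<dots> = real m * harm m"
    by (simp add: harm_def sum_distrib_left)
  finally have 1: "\<bar>(\<Sum>k=1..m. real (totient k)) - (real m)\<^sup>2 / 2 * P\<bar> \<le> real m * harm m" .
  have "\<bar>(real m)\<^sup>2 / 2 * P - (real m)\<^sup>2 / (2 * zeta 2)\<bar> = (real m)\<^sup>2 / 2 * \<bar>P - 1 / zeta 2\<bar>"
  proof -
    have "(real m)\<^sup>2 / 2 * P - (real m)\<^sup>2 / (2 * zeta 2) = (real m)\<^sup>2 / 2 * (P - 1 / zeta 2)"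
      by (simp add: algebra_simps)
    then show ?thesis by (simp only: abs_mult) simp
  qed
  also have "\<dots> \<le> (real m)\<^sup>2 / 2 * (2 * harm m / real m)"
    using sum_mobius_squares_approx[OF m] by (intro mult_left_mono) (auto simp: P_def)
  also have "\<dots> = real m * harm m"
    using m by (simp add: power2_eq_square)
  finally show ?thesis using 1 by linarith
qed simp

subsection \<open>Solutions of \<open>x * y \<equiv> r\<close> modulo \<open>m\<close>\<close>

text \<open>Residues are represented by 1..m rather than 0..m-1, the range over which totients count
  the elements of given gcd with m.\<close>

definition mult_cong_pairs :: "int \<Rightarrow> int \<Rightarrow> (int \<times> int) set" where
  "mult_cong_pairs r m = {(x, y). x \<in> {1..m} \<and> y \<in> {1..m} \<and> m dvd x * y - r}"

text \<open>The interval consists of g full periods, and each contains exactly one element of the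
  class.\<close>

lemma card_residue_class:
  fixes m c :: int
  assumes "m > 0"
  shows "card {y \<in> {1..int g * m}. m dvd y - c} = g"
proof -
  \<comment> \<open>The two shifts by 1 move the range of \<open>mod\<close> from 0..m-1 to
    1..m.\<close>
  define e where "e = (c - 1) mod m + 1"
  have e: "1 \<le> e" "e \<le> m" "m dvd e - c"
  proof -
    show "1 \<le> e" "e \<le> m"
      using pos_mod_bound[OF assms, of "c - 1"] pos_mod_sign[OF assms, of "c - 1"]
      unfolding e_def by linarith+
    have "e - c = - (m * ((c - 1) div m))"
      by (simp add: e_def minus_mult_div_eq_mod[symmetric])
    then show "m dvd e - c" by simp
  qed
  have "bij_betw (\<lambda>k. e + m * int k) {..<g} {y \<in> {1..int g * m}. m dvd y - c}"
  proof (rule bij_betw_imageI)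
    show "inj_on (\<lambda>k. e + m * int k) {..<g}"
      using assms by (auto simp: inj_on_def)
    show "(\<lambda>k. e + m * int k) ` {..<g} = {y \<in> {1..int g * m}. m dvd y - c}"
    proof (intro equalityI subsetI)
      fix y assume "y \<in> (\<lambda>k. e + m * int k) ` {..<g}"
      then obtain k where k: "k < g" "y = e + m * int k" by auto
      have "m * int k \<le> m * (int g - 1)"
        using k assms by (intro mult_left_mono) auto
      also have "\<dots> = int g * m - m"
        by (simp add: algebra_simps)
      finally have "y \<le> int g * m"
        using e k by linarith
      have "0 \<le> m * int k"
        using assms by simp
      then have "1 \<le> y"
        using e k by linarith
      have "m dvd y - c"
        using dvd_add[OF e(3) dvd_triv_left[of m "int k"]] by (simp add: k algebra_simps)
      then show "y \<in> {y \<in> {1..int g * m}. m dvd y - c}"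
        using \<open>y \<le> int g * m\<close> \<open>1 \<le> y\<close> by simp
    next
      fix y assume "y \<in> {y \<in> {1..int g * m}. m dvd y - c}"
      then have y: "1 \<le> y" "y \<le> int g * m" "m dvd y - c" by auto
      then have "m dvd (y - c) - (e - c)" using e(3) by (rule_tac dvd_diff)
      then obtain k where k: "y - e = m * k" by (auto simp: dvd_def)
      have "m * k > m * (-1)" using k y e by simp
      then have "k \<ge> 0" using assms by (simp only: mult_less_cancel_left_pos)
      have "y - e < m * int g" using y e mult.commute[of m "int g"] by linarith
      then have "m * k < m * int g" using k by simp
      then have "k < int g" using assms by (simp only: mult_less_cancel_left_pos)
      then show "y \<in> (\<lambda>k. e + m * int k) ` {..<g}"
        using \<open>k \<ge> 0\<close> k by (intro image_eqI[of _ _ "nat k"]) auto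
    qed
  qed
  from bij_betw_same_card[OF this] show ?thesis by simp
qed

text \<open>Dividing by g = gcd x m makes the coefficient invertible modulo m' = m / g, so the
  solutions form one class modulo m', which has g members in 1..m. If g does not divide r there are
  none, since g divides both x * y and m.\<close>

lemma card_linear_congruence:
  fixes x m r :: int
  assumes "m > 0"
  shows "card {y \<in> {1..m}. m dvd x * y - r} = (if gcd x m dvd r then nat (gcd x m) else 0)"
proof (cases "gcd x m dvd r")
  case False
  have "\<not> m dvd x * y - r" for y
  proof
    assume "m dvd x * y - r"
    then have "gcd x m dvd x * y - (x * y - r)"
      by (meson dvd_diff dvd_mult2 dvd_trans gcd_dvd1 gcd_dvd2)
    then show False using False by simp
  qed
  then show ?thesis using False by simp
next
  case True
  define g where "g = gcd x m"
  have g: "g > 0" using assms by (simp add: g_def)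
  obtain x' m' where xm: "x = g * x'" "m = g * m'" "coprime x' m'"
    using gcd_coprime_exists[of x m] g unfolding g_def by (metis less_irrefl mult.commute)
  obtain r' where r: "r = g * r'" using True by (auto simp: g_def)
  have m': "m' > 0" using assms g xm(2) by (simp add: zero_less_mult_iff)
  obtain i where i: "[x' * i = 1] (mod m')"
    using xm(3) coprime_iff_invertible_int by blast
  have iff: "m dvd x * y - r \<longleftrightarrow> m' dvd y - i * r'" for y
  proof -
    have "x * y - r = g * (x' * y - r')" by (simp add: xm r algebra_simps)
    then have "m dvd x * y - r \<longleftrightarrow> m' dvd x' * y - r'" using g xm(2) by simp
    also have "\<dots> \<longleftrightarrow> [x' * y = r'] (mod m')" by (simp add: cong_iff_dvd_diff)
    also have "\<dots> \<longleftrightarrow> [x' * y = x' * (i * r')] (mod m')"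
    proof -
      have "[x' * (i * r') = r'] (mod m')"
        using cong_mult[OF i cong_refl[of r' m']] by (simp add: mult.assoc)
      then show ?thesis by (simp add: cong_def)
    qed
    also have "\<dots> \<longleftrightarrow> [y = i * r'] (mod m')"
      using xm(3) by (rule cong_mult_lcancel)
    finally show ?thesis by (simp add: cong_iff_dvd_diff)
  qed
  have "m = int (nat g) * m'" using g xm(2) by simp
  then have "card {y \<in> {1..m}. m' dvd y - i * r'} = nat g"
    using card_residue_class[OF m', of "nat g" "i * r'"] by (simp only:)
  then have "card {y \<in> {1..m}. m dvd x * y - r} = nat g"
    by (simp only: iff)
  then show ?thesis using True by (simp add: g_def)
qed

text \<open>The x are grouped by g = gcd x m: there are totient (m div g) of them, and each admits g
  values of y if g divides r and none otherwise.\<close>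

lemma card_mult_cong_pairs:
  assumes "m > 0"
  shows "card (mult_cong_pairs r (int m)) =
    (\<Sum>g | g dvd m. if g dvd nat \<bar>r\<bar> then g * totient (m div g) else 0)"
proof -
  define h where "h k = (if gcd k m dvd nat \<bar>r\<bar> then gcd k m else 0)" for k
  have "mult_cong_pairs r (int m) =
      Sigma {1..int m} (\<lambda>x. {y \<in> {1..int m}. int m dvd x * y - r})"
    by (auto simp: mult_cong_pairs_def)
  then have "card (mult_cong_pairs r (int m)) =
      (\<Sum>x\<in>{1..int m}. card {y \<in> {1..int m}. int m dvd x * y - r})"
    by (simp only:) (rule card_SigmaI; simp del: atLeastAtMost_iff)
  also have "\<dots> = (\<Sum>x\<in>{1..int m}. h (nat x))"
  proof (intro sum.cong refl)
    fix x assume "x \<in> {1..int m}"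
    then have "x = int (nat x)" by simp
    then obtain k where "x = int k" by blast
    then show "card {y \<in> {1..int m}. int m dvd x * y - r} = h (nat x)"
      using card_linear_congruence[of "int m" "int k" r] assms by (simp add: h_def)
  qed
  also have "\<dots> = (\<Sum>k\<in>{0<..m}. h k)"
    by (rule sum.reindex_bij_witness[where i = int and j = nat]) auto
  also have "\<dots> = (\<Sum>g | g dvd m. \<Sum>k | k \<in> {0<..m} \<and> gcd k m = g. h k)"
    using assms by (intro sum.group[symmetric]) auto
  also have "\<dots> = (\<Sum>g | g dvd m. if g dvd nat \<bar>r\<bar> then g * totient (m div g) else 0)"
    using assms by (intro sum.cong refl) (simp add: h_def card_gcd_eq_totient[symmetric])
  finally show ?thesis .
qed

lemma card_mult_cong_pairs_le:
  "card (mult_cong_pairs r (int m)) \<le> m\<^sup>2"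
proof -
  have "card (mult_cong_pairs r (int m)) \<le> card ({1..int m} \<times> {1..int m})"
    by (intro card_mono) (auto simp: mult_cong_pairs_def)
  then show ?thesis by (simp add: power2_eq_square)
qed

subsection \<open>Matrices of determinant \<open>r\<close>, sorted by their largest entry\<close>

definition det_box :: "int \<Rightarrow> int \<Rightarrow> (int \<times> int \<times> int \<times> int) set" where
  "det_box r m = {(a, b, c, d). a * d - b * c = r \<and> \<bar>a\<bar> \<le> m \<and> \<bar>b\<bar> \<le> m \<and> \<bar>c\<bar> \<le> m \<and> \<bar>d\<bar> \<le> m}"

lemma det_count_eq_card_det_box: "det_count r X = card (det_box r \<lfloor>X\<rfloor>)"
  by (simp add: det_count_def det_box_def le_floor_iff)

lemma finite_det_box: "finite (det_box r m)"
  by (rule finite_subset[of _ "{-m..m} \<times> {-m..m} \<times> {-m..m} \<times> {-m..m}"]) (auto simp: det_box_def)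

text \<open>Three entries determine the fourth: d if a \<noteq> 0; if a = 0, then c \<noteq> 0
  because r \<noteq> 0, and b is determined by c. The exponent 3 keeps the boxes of size up to
  \<bar>r\<bar> within the error term.\<close>

lemma card_det_box_le:
  assumes "r \<noteq> 0"
  shows "card (det_box r (int n)) \<le> 2 * (2 * n + 1) ^ 3"
proof -
  define I where "I = {- int n..int n}"
  have cI: "card I = 2 * n + 1" by (simp add: I_def)
  have "card {(a, b, c, d) \<in> det_box r (int n). a \<noteq> 0} \<le> card (I \<times> I \<times> I)"
  proof (rule card_inj_on_le[where f = "\<lambda>(a, b, c, d). (a, b, c)"])
    show "inj_on (\<lambda>(a, b, c, d). (a, b, c)) {(a, b, c, d) \<in> det_box r (int n). a \<noteq> 0}"
    proof (rule inj_onI)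
      fix p q
      assume "p \<in> {(a, b, c, d) \<in> det_box r (int n). a \<noteq> 0}" "q \<in> {(a, b, c, d) \<in> det_box r (int n). a \<noteq> 0}"
        and eq: "(\<lambda>(a, b, c, d). (a, b, c)) p = (\<lambda>(a, b, c, d). (a, b, c)) q"
      then obtain a b c d d' where pq: "p = (a, b, c, d)" "q = (a, b, c, d')" "a \<noteq> 0"
        "a * d - b * c = r" "a * d' - b * c = r"
        by (auto simp: det_box_def)
      then have "a * d = a * d'" by linarith
      then show "p = q" using pq by simp
    qed
  qed (auto simp: det_box_def I_def)
  moreover have "card {(a, b, c, d) \<in> det_box r (int n). a = 0} \<le> card (I \<times> I \<times> I)"
  proof (rule card_inj_on_le[where f = "\<lambda>(a, b, c, d). (a, c, d)"])
    show "inj_on (\<lambda>(a, b, c, d). (a, c, d)) {(a, b, c, d) \<in> det_box r (int n). a = 0}"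
    proof (rule inj_onI)
      fix p q
      assume "p \<in> {(a, b, c, d) \<in> det_box r (int n). a = 0}" "q \<in> {(a, b, c, d) \<in> det_box r (int n). a = 0}"
        and eq: "(\<lambda>(a, b, c, d). (a, c, d)) p = (\<lambda>(a, b, c, d). (a, c, d)) q"
      then obtain b b' c d where pq: "p = (0, b, c, d)" "q = (0, b', c, d)"
        "- (b * c) = r" "- (b' * c) = r"
        by (auto simp: det_box_def)
      then have "b * c = b' * c" by linarith
      moreover have "c \<noteq> 0" using pq assms by auto
      ultimately show "p = q" using pq by simp
    qed
  qed (auto simp: det_box_def I_def)
  moreover have "{(a, b, c, d) \<in> det_box r (int n). a \<noteq> 0} \<union> {(a, b, c, d) \<in> det_box r (int n). a = 0} =
      det_box r (int n)"
    by auto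
  then have "card (det_box r (int n)) \<le>
      card {(a, b, c, d) \<in> det_box r (int n). a \<noteq> 0} + card {(a, b, c, d) \<in> det_box r (int n). a = 0}"
    using card_Un_le[of "{(a, b, c, d) \<in> det_box r (int n). a \<noteq> 0}"
        "{(a, b, c, d) \<in> det_box r (int n). a = 0}"] by (simp only:)
  moreover have "card (I \<times> I \<times> I) = (2 * n + 1) ^ 3"
    by (simp only: card_cartesian_product cI power3_eq_cube mult.assoc)
  ultimately show ?thesis by linarith
qed

text \<open>One position serves for all four: symmetries preserving the determinant carry the other
  three to it.\<close>

definition corner :: "int \<Rightarrow> int \<Rightarrow> (int \<times> int \<times> int \<times> int) set" where
  "corner r m = {(a, b, c, d) \<in> det_box r m. \<bar>c\<bar> = m}"

section \<open>Matrices with largest entry m > \<bar>r\<bar>\<close>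

context
  fixes r m :: int
  assumes m: "\<bar>r\<bar> < m" and r: "r \<noteq> 0"
begin

lemma not_dvd_r: "\<not> m dvd r"
  using m r zdvd_not_zless[of "\<bar>r\<bar>" m] by auto

lemma abs_eq_imp_dvd: "\<bar>x\<bar> = m \<Longrightarrow> m dvd x"
  by auto

text \<open>If \<bar>a\<bar> or \<bar>d\<bar> were m, then m would divide r. Hence both are at most
  m - 1, and \<bar>b\<bar> * m \<le> (m - 1)^2 + \<bar>r\<bar> < m^2.\<close>

lemma corner_quotient_bound:
  assumes "a * d - b * c = r" "\<bar>c\<bar> = m" "\<bar>a\<bar> \<le> m" "\<bar>d\<bar> \<le> m"
  shows "\<bar>b\<bar> < m"
proof -
  have "\<bar>a\<bar> \<noteq> m" "\<bar>d\<bar> \<noteq> m"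
    using not_dvd_r assms abs_eq_imp_dvd by (metis dvd_diff dvd_mult dvd_mult2)+
  then have "\<bar>a\<bar> \<le> m - 1" "\<bar>d\<bar> \<le> m - 1" using assms by auto
  then have "\<bar>a\<bar> * \<bar>d\<bar> \<le> (m - 1) * (m - 1)"
    by (intro mult_mono) auto
  moreover have "\<bar>b\<bar> * m = \<bar>a * d - r\<bar>"
    using assms by (metis abs_mult add_diff_cancel_left' diff_add_cancel diff_diff_eq2)
  ultimately have "\<bar>b\<bar> * m < (m - 1) * (m - 1) + m"
    using m abs_triangle_ineq4[of "a * d" r] by (simp add: abs_mult)
  also have "\<dots> \<le> m * m" using m by (simp add: algebra_simps)
  finally show ?thesis using m by (simp add: mult_less_cancel_right)
qed

lemma card_corner: "card (corner r m) = 8 * card (mult_cong_pairs r m)"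
proof -
  have m0: "m > 0" using m by linarith
  \<comment> \<open>The parameters are c = s, the shifts t and u choosing between the
    representatives x and x - m for a (likewise y and y - m for d), and the residues; b is the
    forced quotient. The three binary choices give the factor 8.\<close>
  define A where "A = {m, -m} \<times> {0, m} \<times> {0, m} \<times> mult_cong_pairs r m"
  define f where "f = (\<lambda>(s, t, u, x, y). (x - t, ((x - t) * (y - u) - r) div s, s, y - u))"
  \<comment> \<open>A residue m would force m dvd r. Without it, x is positive and x - m is
    negative, so the sign of the entry recovers the shift.\<close>
  have xy: "x < m \<and> y < m" if "(x, y) \<in> mult_cong_pairs r m" for x y
  proof -
    have *: "m dvd x * y - r" "1 \<le> x" "x \<le> m" "1 \<le> y" "y \<le> m"
      using that by (auto simp: mult_cong_pairs_def)
    have "x \<noteq> m" "y \<noteq> m"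
      using *(1) not_dvd_r by (auto simp: dvd_diff_right_iff dvd_diff_left_iff)
    then show ?thesis using * by auto
  qed
  have "bij_betw f A (corner r m)"
  proof (rule bij_betw_imageI)
    show "inj_on f A"
    proof (rule inj_onI)
      fix p q assume "p \<in> A" "q \<in> A" "f p = f q"
      then show "p = q"
        using m0 by (auto simp: A_def f_def mult_cong_pairs_def dest!: xy)
    qed
    show "f ` A = corner r m"
    proof (intro equalityI subsetI)
      fix w assume "w \<in> f ` A"
      then obtain s t u x y where w: "w = f (s, t, u, x, y)" "s \<in> {m, -m}" "t \<in> {0, m}" "u \<in> {0, m}"
        "(x, y) \<in> mult_cong_pairs r m" by (auto simp: A_def)
      define a d where "a = x - t" and "d = y - u"
      have xm: "1 \<le> x" "1 \<le> y" "x < m" "y < m" "m dvd x * y - r"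
        using w(5) xy[OF w(5)] by (auto simp: mult_cong_pairs_def)
      have "a * d - r = (x * y - r) - x * u - t * y + t * u"
        by (simp add: a_def d_def algebra_simps)
      also have "m dvd \<dots>"
        using w(3,4) dvd_diff[OF dvd_diff[OF xm(5)], of "x * u" "t * y"] by (intro dvd_add) auto
      finally have dv: "m dvd a * d - r" .
      then have "s dvd a * d - r" using w(2) by auto
      then have eq: "a * d - (a * d - r) div s * s = r" by simp
      have ad: "\<bar>a\<bar> \<le> m" "\<bar>d\<bar> \<le> m" using w xm by (auto simp: a_def d_def)
      have s: "\<bar>s\<bar> = m" using w(2) m0 by auto
      have "\<bar>(a * d - r) div s\<bar> < m"
        by (rule corner_quotient_bound[OF eq s ad])
      then show "w \<in> corner r m"
        using eq s ad by (simp add: w f_def corner_def det_box_def a_def d_def)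
    next
      fix w assume "w \<in> corner r m"
      then obtain a b c d where w: "w = (a, b, c, d)" "a * d - b * c = r" "\<bar>a\<bar> \<le> m" "\<bar>d\<bar> \<le> m" "\<bar>c\<bar> = m"
        by (auto simp: corner_def det_box_def)
      \<comment> \<open>The inverse map reads the shift off the sign. The values -m are excluded by
        divisibility, so the shifted entries are at least 1.\<close>
      define t u where "t = (if a > 0 then 0 else m)" and "u = (if d > 0 then 0 else m)"
      have mc: "m dvd c" using w(5) by auto
      have "\<not> m dvd a" "\<not> m dvd d"
        using w(2) not_dvd_r mc by (metis dvd_diff dvd_mult dvd_mult2)+
      then have "a \<noteq> - m" "d \<noteq> - m" by auto
      then have rng: "a + t \<in> {1..m}" "d + u \<in> {1..m}"
        using w by (auto simp: t_def u_def)
      have "(a + t) * (d + u) - r = b * c + a * u + t * d + t * u"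
        using w(2) by (simp add: algebra_simps)
      also have "m dvd \<dots>"
        using mc by (intro dvd_add) (auto simp: t_def u_def)
      finally have "(a + t, d + u) \<in> mult_cong_pairs r m"
        using rng by (simp add: mult_cong_pairs_def)
      moreover have "c \<in> {m, -m}" using w(5) by auto
      ultimately have "(c, t, u, a + t, d + u) \<in> A"
        by (auto simp: A_def t_def u_def)
      moreover have "(a * d - r) div c = b"
        using w m0 by (auto simp: nonzero_mult_div_cancel_right)
      then have "w = f (c, t, u, a + t, d + u)"
        by (simp add: f_def w)
      ultimately show "w \<in> f ` A" by blast
    qed
  qed
  then have "card (corner r m) = card A" by (simp add: bij_betw_same_card)
  also have "\<dots> = 8 * card (mult_cong_pairs r m)"
    using m0 by (simp add: A_def card_cartesian_product card_insert_if)
  finally show ?thesis .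
qed

text \<open>Exactly one of the four entries has absolute value m, and the four cases are
  equinumerous with \<open>corner\<close>; 32 = 4 * 8.\<close>

lemma card_det_box_shell:
  "card (det_box r m) = card (det_box r (m - 1)) + 32 * card (mult_cong_pairs r m)"
proof -
  define S1 where "S1 = {(a, b, c, d) \<in> det_box r m. \<bar>a\<bar> = m}"
  define S2 where "S2 = {(a, b, c, d) \<in> det_box r m. \<bar>b\<bar> = m}"
  define S4 where "S4 = {(a, b, c, d) \<in> det_box r m. \<bar>d\<bar> = m}"
  note defs = S1_def S2_def S4_def corner_def det_box_def
  have fin: "finite S1" "finite S2" "finite (corner r m)" "finite S4"
    by (rule finite_subset[OF _ finite_det_box[of r m]]; auto simp: S1_def S2_def S4_def corner_def)+
  \<comment> \<open>Transposition exchanges b and c.\<close>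
  have b2: "bij_betw (\<lambda>(a, b, c, d). (a, c, b, d)) S2 (corner r m)"
    by (rule bij_betw_byWitness[where f' = "\<lambda>(a, b, c, d). (a, c, b, d)"])
       (auto simp: defs mult.commute)
  \<comment> \<open>Right multiplication by the matrix with rows (0, 1) and (-1, 0), of determinant
    1, moves a to the place of b and d, up to sign, to the place of c.\<close>
  have b1: "bij_betw (\<lambda>(a, b, c, d). (- b, a, - d, c)) S1 S2"
    by (rule bij_betw_byWitness[where f' = "\<lambda>(a, b, c, d). (b, - a, d, - c)"])
       (auto simp: defs algebra_simps)
  have b4: "bij_betw (\<lambda>(a, b, c, d). (- b, a, - d, c)) S4 (corner r m)"
    by (rule bij_betw_byWitness[where f' = "\<lambda>(a, b, c, d). (b, - a, d, - c)"])
       (auto simp: defs algebra_simps)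
  have cards: "card S2 = card (corner r m)" "card S1 = card (corner r m)" "card S4 = card (corner r m)"
    using bij_betw_same_card[OF b1] bij_betw_same_card[OF b2] bij_betw_same_card[OF b4] by auto
  have adjacent: False
    if "(a, b, c, d) \<in> det_box r m" "\<bar>a\<bar> = m \<or> \<bar>d\<bar> = m" "\<bar>b\<bar> = m \<or> \<bar>c\<bar> = m" for a b c d
  proof -
    have "m dvd a * d" "m dvd b * c" using that(2,3) abs_eq_imp_dvd dvd_mult dvd_mult2 by blast+
    then have "m dvd a * d - b * c" by (rule dvd_diff)
    then show False using that(1) not_dvd_r by (simp add: det_box_def)
  qed
  have opposite: False
    if "(a, b, c, d) \<in> det_box r m" "\<bar>b\<bar> = m \<and> \<bar>c\<bar> = m \<or> \<bar>a\<bar> = m \<and> \<bar>d\<bar> = m" for a b c d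
    \<comment> \<open>The second instance is the bound for the matrix rotated as in
      \<open>b4\<close>, which treats the diagonal of a and d.\<close>
    using that corner_quotient_bound[of a d b c] corner_quotient_bound[of "- b" c a "- d"]
    by (auto simp: det_box_def)
  have disj: "S1 \<inter> S2 = {} \<and> S1 \<inter> corner r m = {} \<and> S2 \<inter> S4 = {} \<and> corner r m \<inter> S4 = {} \<and>
    S2 \<inter> corner r m = {} \<and> S1 \<inter> S4 = {}"
    unfolding S1_def S2_def S4_def corner_def
    by (insert adjacent opposite, intro conjI; blast)
  have "det_box r m = det_box r (m - 1) \<union> (S1 \<union> S2 \<union> corner r m \<union> S4)"
    by (auto simp: defs)
  moreover have "det_box r (m - 1) \<inter> (S1 \<union> S2 \<union> corner r m \<union> S4) = {}"
    by (auto simp: defs)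
  ultimately have "card (det_box r m) = card (det_box r (m - 1)) + card (S1 \<union> S2 \<union> corner r m \<union> S4)"
    using fin by (simp add: card_Un_disjoint finite_det_box)
  also have "card (S1 \<union> S2 \<union> corner r m \<union> S4) = card S1 + card S2 + card (corner r m) + card S4"
    using fin disj by (simp add: card_Un_disjoint Int_Un_distrib2 Int_Un_distrib)
  finally show ?thesis by (simp add: cards card_corner)
qed

end

text \<open>Up to n = R both terms are bounded trivially; beyond R every shell adds the same amount
  to both, so the difference stays constant.\<close>

lemma card_det_box_approx:
  assumes "r \<noteq> 0" and R: "R = nat \<bar>r\<bar>"
  shows "\<bar>real (card (det_box r (int n))) - 32 * (\<Sum>k=1..n. real (card (mult_cong_pairs r (int k))))\<bar>
         \<le> 86 * real R ^ 3"
proof -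
  define E where "E n = real (card (det_box r (int n))) - 32 * (\<Sum>k=1..n. real (card (mult_cong_pairs r (int k))))" for n
  have R1: "R \<ge> 1" using assms by auto
  have small: "\<bar>E n\<bar> \<le> 86 * real R ^ 3" if "n \<le> R" for n
  proof -
    \<comment> \<open>From n \<le> R and R \<ge> 1. The box then has at most 2 * 27 * R^3 elements,
      and 54 + 32 = 86.\<close>
    have "(2 * n + 1) ^ 3 \<le> (3 * R) ^ 3"
      using that R1 by (intro power_mono) auto
    then have "card (det_box r (int n)) \<le> 54 * R ^ 3"
      using card_det_box_le[OF assms(1), of n] by (simp add: power_mult_distrib)
    then have "real (card (det_box r (int n))) \<le> real (54 * R ^ 3)"
      by (simp only: of_nat_le_iff)
    moreover have "(\<Sum>k=1..n. real (card (mult_cong_pairs r (int k)))) \<le> (\<Sum>k=1..n. real (R\<^sup>2))"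
    proof (intro sum_mono, unfold of_nat_le_iff)
      fix k assume "k \<in> {1..n}"
      then have "k\<^sup>2 \<le> R\<^sup>2" using that by (intro power_mono) auto
      then show "card (mult_cong_pairs r (int k)) \<le> R\<^sup>2"
        using card_mult_cong_pairs_le[of r k] by linarith
    qed
    moreover have "(\<Sum>k=1..n. real (R\<^sup>2)) \<le> real R ^ 3"
      using that by (simp add: power2_eq_square power3_eq_cube mult_right_mono mult.assoc)
    moreover have "(\<Sum>k=1..n. real (card (mult_cong_pairs r (int k)))) \<ge> 0"
      by (intro sum_nonneg) auto
    ultimately show ?thesis
      unfolding E_def abs_le_iff by auto
  qed
  have large: "E n = E R" if "n \<ge> R" for n
    using that
  proof (induction n rule: dec_induct)
    case (step n)
    have "card (det_box r (int (Suc n))) =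
        card (det_box r (int n)) + 32 * card (mult_cong_pairs r (int (Suc n)))"
      using card_det_box_shell[of r "int (Suc n)"] assms step.hyps by auto
    then show ?case using step.IH by (simp add: E_def)
  qed simp
  have "\<bar>E n\<bar> \<le> 86 * real R ^ 3"
  proof (cases "n \<le> R")
    case False
    then show ?thesis using small[of R] large[of n] by simp
  qed (rule small)
  then show ?thesis by (simp add: E_def)
qed

subsection \<open>The asymptotic formula\<close>

lemma sum_card_mult_cong_pairs:
  assumes "R = nat \<bar>r\<bar>" "R > 0"
  shows "(\<Sum>k=1..n. real (card (mult_cong_pairs r (int k)))) =
    (\<Sum>g | g dvd R. real g * (\<Sum>k=1..n div g. real (totient k)))"
proof -
  have fin: "finite {g. g dvd R}" using assms(2) by simp
  define h where "h g = real g * (\<Sum>k=1..n div g. real (totient k))" for g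
  have "(\<Sum>k=1..n. real (card (mult_cong_pairs r (int k)))) =
      (\<Sum>k=1..n. \<Sum>g | g dvd k. (if g dvd R then real g else 0) * real (totient (k div g)))"
  proof (intro sum.cong refl)
    fix k assume "k \<in> {1..n}"
    then have k: "k > 0" by simp
    show "real (card (mult_cong_pairs r (int k))) =
        (\<Sum>g | g dvd k. (if g dvd R then real g else 0) * real (totient (k div g)))"
      unfolding card_mult_cong_pairs[OF k] assms(1)[symmetric] of_nat_sum
      by (intro sum.cong refl) simp
  qed
  also have "\<dots> = (\<Sum>g=1..n. \<Sum>k=1..n div g. (if g dvd R then real g else 0) * real (totient k))"
    by (rule sum_divisors_swap)
  also have "\<dots> = (\<Sum>g\<in>{1..n}. if g dvd R then h g else 0)"
    by (intro sum.cong refl) (auto simp: h_def sum_distrib_left)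
  also have "\<dots> = (\<Sum>g\<in>{1..n} \<inter> {g. g dvd R}. h g)"
    by (simp add: sum.inter_restrict)
  \<comment> \<open>Divisors g > n give n div g = 0 and an empty inner sum, so they may be
    added.\<close>
  also have "\<dots> = (\<Sum>g | g dvd R. h g)"
  proof (rule sum.mono_neutral_left[OF fin])
    show "\<forall>g\<in>{g. g dvd R} - {1..n} \<inter> {g. g dvd R}. h g = 0"
    proof
      fix g assume g: "g \<in> {g. g dvd R} - {1..n} \<inter> {g. g dvd R}"
      then have "g \<noteq> 0" using assms(2) by auto
      then have "n < g" using g by auto
      then show "h g = 0" by (simp add: h_def)
    qed
  qed auto
  finally show ?thesis by (simp add: h_def)
qed

text \<open>The involution g to n div g on the divisors. It produces the factor sigma(\<bar>r\<bar>)
  / \<bar>r\<bar> of the main term.\<close>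

lemma sum_inverse_divisors:
  assumes "n > 0"
  shows "(\<Sum>g | g dvd n. 1 / real g) = real (divisor_sum n) / real n"
proof -
  have "(\<Sum>g | g dvd n. 1 / real g) = (\<Sum>g | g dvd n. real g / real n)"
    by (rule sum.reindex_bij_witness[where i = "\<lambda>g. n div g" and j = "\<lambda>g. n div g"])
       (use assms in \<open>auto simp: real_of_nat_div elim!: dvdE\<close>)
  then show ?thesis by (simp add: divisor_sum_def sum_divide_distrib)
qed

lemma harm_le_1_plus_ln:
  assumes "n > 0"
  shows "harm n \<le> 1 + ln (real n)"
  using euler_mascheroni_sequence_decreasing[of 1 n] assms by (simp add: harm_expand)

text \<open>A divisor g contributes g * (X / g)^2 / (2 * zeta 2) up to an error of g * (X / g) * log
  X, in which g cancels; the error is then multiplied by the number of divisors.\<close>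

lemma sum_card_mult_cong_pairs_approx:
  fixes X :: real
  assumes "R = nat \<bar>r\<bar>" "R > 0" "X \<ge> 1"
  shows "\<bar>(\<Sum>k=1..nat \<lfloor>X\<rfloor>. real (card (mult_cong_pairs r (int k)))) -
      X\<^sup>2 / (2 * zeta 2) * (real (divisor_sum R) / real R)\<bar> \<le> 3 * X * (1 + ln X) * real R"
proof -
  define n where "n = nat \<lfloor>X\<rfloor>"
  have n: "real n \<le> X" "X < real n + 1" using assms(3) by (auto simp: n_def)
  have z: "zeta 2 \<ge> 1" by (rule zeta_2_ge_1)
  have "(\<Sum>k=1..n. real (card (mult_cong_pairs r (int k)))) - X\<^sup>2 / (2 * zeta 2) * (real (divisor_sum R) / real R)
      = (\<Sum>g | g dvd R. real g * (\<Sum>k=1..n div g. real (totient k)) - X\<^sup>2 / (2 * zeta 2) * (1 / real g))"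
    unfolding sum_card_mult_cong_pairs[OF assms(1,2)] sum_inverse_divisors[OF assms(2), symmetric]
      sum_subtractf sum_distrib_left ..
  also have "\<bar>\<dots>\<bar> \<le> (\<Sum>g | g dvd R. 3 * X * (1 + ln X))"
  proof (rule order_trans[OF sum_abs sum_mono])
    fix g assume "g \<in> {g. g dvd R}"
    then have g: "g > 0" using assms(2) by (auto intro: dvd_pos_nat)
    define q where "q = n div g"
    define y where "y = X / real g"
    define T where "T = (\<Sum>k=1..q. real (totient k))"
    have y: "real q \<le> y" "y \<le> real q + 1"
    proof -
      have "real q \<le> real n / real g" unfolding q_def by (rule real_div_bounds[OF g])
      also have "\<dots> \<le> y" using n by (simp add: y_def divide_right_mono)
      finally show "real q \<le> y" .
      have "n + 1 \<le> (q + 1) * g"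
        using dividend_less_div_times[OF g, of n] by (simp add: q_def)
      then have "real n + 1 \<le> (real q + 1) * real g"
        by (metis of_nat_1 of_nat_add of_nat_le_iff of_nat_mult)
      then have "X \<le> (real q + 1) * real g" using n by linarith
      then show "y \<le> real q + 1" using g by (simp add: y_def pos_divide_le_eq)
    qed
    have y0: "y \<ge> 0" using assms(3) by (simp add: y_def)
    have "real q * harm q \<le> real q * (1 + ln X)"
    proof (cases "q = 0")
      case False
      have "real q \<le> X"
        using n(1) div_le_dividend[of n g] unfolding q_def by linarith
      then have "ln (real q) \<le> ln X"
        using False by simp
      then have "harm q \<le> 1 + ln X"
        using harm_le_1_plus_ln[of q] False by simp
      then show ?thesis by (rule mult_left_mono) simp
    qed simp
    then have "\<bar>T - (real q)\<^sup>2 / (2 * zeta 2)\<bar> \<le> 2 * (real q * (1 + ln X))"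
      using sum_totient_approx[of q] unfolding T_def by linarith
    also have "\<dots> \<le> 2 * (y * (1 + ln X))"
      using y assms(3) by (intro mult_left_mono mult_right_mono) auto
    finally have 1: "\<bar>T - (real q)\<^sup>2 / (2 * zeta 2)\<bar> \<le> 2 * (y * (1 + ln X))" .
    have sq: "0 \<le> y\<^sup>2 - (real q)\<^sup>2" "y\<^sup>2 - (real q)\<^sup>2 \<le> 2 * y"
    proof -
      have eq: "y\<^sup>2 - (real q)\<^sup>2 = (y - real q) * (y + real q)"
        by (simp add: power2_eq_square algebra_simps)
      show "0 \<le> y\<^sup>2 - (real q)\<^sup>2" unfolding eq using y by (intro mult_nonneg_nonneg) auto
      have "(y - real q) * (y + real q) \<le> 1 * (2 * y)" using y y0 by (intro mult_mono) auto
      then show "y\<^sup>2 - (real q)\<^sup>2 \<le> 2 * y" unfolding eq by simp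
    qed
    \<comment> \<open>Undoing the rounding costs at most y, which with the 2 * y * (1 + ln X) of the
      totient estimate gives the constant 3.\<close>
    have "\<bar>(real q)\<^sup>2 / (2 * zeta 2) - y\<^sup>2 / (2 * zeta 2)\<bar> = (y\<^sup>2 - (real q)\<^sup>2) / (2 * zeta 2)"
      using sq z by (simp add: diff_divide_distrib[symmetric] abs_divide)
    also have "\<dots> \<le> (2 * y) / 2"
      using sq z y0 by (intro frac_le) auto
    also have "\<dots> \<le> y * (1 + ln X)"
      using y0 assms(3) mult_left_mono[of 1 "1 + ln X" y] by simp
    finally have "\<bar>T - y\<^sup>2 / (2 * zeta 2)\<bar> \<le> 3 * (y * (1 + ln X))"
      using 1 by linarith
    then have "real g * \<bar>T - y\<^sup>2 / (2 * zeta 2)\<bar> \<le> real g * (3 * (y * (1 + ln X)))"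
      by (intro mult_left_mono) auto
    also have "real g * (3 * (y * (1 + ln X))) = 3 * X * (1 + ln X)"
      using g by (simp add: y_def)
    also have "real g * \<bar>T - y\<^sup>2 / (2 * zeta 2)\<bar> = \<bar>real g * (T - y\<^sup>2 / (2 * zeta 2))\<bar>"
      by (simp add: abs_mult)
    also have "real g * (T - y\<^sup>2 / (2 * zeta 2)) = real g * T - X\<^sup>2 / (2 * zeta 2) * (1 / real g)"
      using g by (simp add: y_def field_simps power2_eq_square)
    finally show "\<bar>real g * (\<Sum>k=1..n div g. real (totient k)) - X\<^sup>2 / (2 * zeta 2) * (1 / real g)\<bar>
        \<le> 3 * X * (1 + ln X)"
      by (simp only: T_def q_def)
  qed
  also have "\<dots> = 3 * X * (1 + ln X) * real (card {g. g dvd R})"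
    by simp
  also have "\<dots> \<le> 3 * X * (1 + ln X) * real R"
  proof -
    \<comment> \<open>This crude divisor bound suffices: for R = O(X^(1/3)) the total error is
      O(X^(4/3) * log X).\<close>
    have "card {g. g dvd R} \<le> card {1..R}"
      using assms(2) by (intro card_mono) (auto simp: dvd_imp_le Suc_le_eq intro: dvd_pos_nat)
    then show ?thesis using assms(3) by (intro mult_left_mono) auto
  qed
  finally show ?thesis by (simp add: n_def)
qed

text \<open>Multiplying the preceding estimate by the 32 matrices per solution gives 96 = 32 * 3 and
  the main constant 32 / (2 * zeta 2) = 16 / zeta 2; the cubic term comes from the shells up to
  \<bar>r\<bar>.\<close>

lemma det_count_approx:
  fixes X :: real
  assumes "X \<ge> 1" "r \<noteq> 0"
  shows "\<bar>real (det_count r X) - 16 / zeta 2 * (real (divisor_sum (nat \<bar>r\<bar>)) / real_of_int \<bar>r\<bar>) * X\<^sup>2\<bar>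
    \<le> 96 * X * (1 + ln X) * real_of_int \<bar>r\<bar> + 86 * real_of_int \<bar>r\<bar> ^ 3"
proof -
  define R where "R = nat \<bar>r\<bar>"
  define S where "S = (\<Sum>k=1..nat \<lfloor>X\<rfloor>. real (card (mult_cong_pairs r (int k))))"
  define M where "M = X\<^sup>2 / (2 * zeta 2) * (real (divisor_sum R) / real R)"
  have R: "R > 0" "real R = real_of_int \<bar>r\<bar>" using assms by (auto simp: R_def)
  have "\<bar>real (det_count r X) - 32 * S\<bar> \<le> 86 * real R ^ 3"
    using card_det_box_approx[OF assms(2) R_def, of "nat \<lfloor>X\<rfloor>"] assms(1)
    by (simp add: det_count_eq_card_det_box S_def)
  moreover have "\<bar>S - M\<bar> \<le> 3 * X * (1 + ln X) * real R"
    unfolding S_def M_def by (rule sum_card_mult_cong_pairs_approx[OF R_def R(1) assms(1)])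
  ultimately have "\<bar>real (det_count r X) - 32 * M\<bar> \<le> 96 * X * (1 + ln X) * real R + 86 * real R ^ 3"
    by linarith
  moreover have "32 * M = 16 / zeta 2 * (real (divisor_sum R) / real R) * X\<^sup>2"
    by (simp add: M_def field_simps)
  ultimately show ?thesis unfolding R(2)[symmetric] R_def[symmetric] by simp
qed

theorem theorem1p1:
  fixes u :: "nat \<Rightarrow> complex \<Rightarrow> complex"
  assumes "hecke_maass_basis u"
  shows "\<forall>\<epsilon>>0. \<forall>K>0. \<exists>C. \<forall>\<theta>. admissible u \<theta> \<longrightarrow>
    (\<forall>X::real. \<forall>r::int. X \<ge> 1 \<longrightarrow> r \<noteq> 0 \<longrightarrow>
       real_of_int \<bar>r\<bar> \<le> K * X powr (1/3) \<longrightarrow>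
       \<bar>real (det_count r X)
          - 16 / zeta 2 * (real (divisor_sum (nat \<bar>r\<bar>)) / real_of_int \<bar>r\<bar>) * X\<^sup>2\<bar>
         \<le> C * (real_of_int \<bar>r\<bar> powr \<theta> * X powr (3/2 + \<epsilon>)))"
proof (intro allI impI, rule exI, intro allI impI)
  fix \<epsilon> K \<theta> X :: real and r :: int
  assume \<epsilon>: "\<epsilon> > 0" and K: "K > 0" and \<theta>: "admissible u \<theta>" and X: "X \<ge> 1" and r: "r \<noteq> 0"
    and rK: "real_of_int \<bar>r\<bar> \<le> K * X powr (1/3)"
  define R where "R = real_of_int \<bar>r\<bar>"
  \<comment> \<open>Here 672 = 96 * 7. The witness left schematic by \<open>exI\<close> is fixed by
    the final \<open>show\<close>, which therefore spells this value out.\<close>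
  define C where "C = 672 * K + 86 * K ^ 3"
  have R1: "R \<ge> 1" using r by (simp add: R_def)
  \<comment> \<open>The exponent 1/6 is chosen because 1 + 1/6 + 1/3 = 3/2.\<close>
  have "ln X \<le> 6 * X powr (1/6)"
    using ln_powr_bound[OF X, of "1/6"] by simp
  moreover have "X powr (1/6) \<ge> 1" using X by (simp add: ge_one_powr_ge_zero)
  ultimately have log: "1 + ln X \<le> 7 * X powr (1/6)" by linarith
  have "96 * X * (1 + ln X) * R \<le> 96 * X * (7 * X powr (1/6)) * (K * X powr (1/3))"
    using log rK R1 X by (intro mult_mono) (auto simp: R_def)
  also have "\<dots> = 672 * K * X powr (3/2)"
    using X powr_add[of X 1 "1/6"] powr_add[of X "1 + 1/6" "1/3"] by simp
  finally have 1: "96 * X * (1 + ln X) * R \<le> 672 * K * X powr (3/2)" .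
  have "R ^ 3 \<le> (K * X powr (1/3)) ^ 3"
    using rK R1 by (intro power_mono) (auto simp: R_def)
  also have "\<dots> = K ^ 3 * X powr 1"
    using X by (simp add: power_mult_distrib powr_power)
  also have "\<dots> \<le> K ^ 3 * X powr (3/2)"
    using X K by (intro mult_left_mono powr_mono) auto
  finally have "96 * X * (1 + ln X) * R + 86 * R ^ 3 \<le> C * X powr (3/2)"
    using 1 by (simp add: C_def algebra_simps)
  also have "\<dots> \<le> C * (R powr \<theta> * X powr (3/2 + \<epsilon>))"
  proof (rule mult_left_mono)
    \<comment> \<open>Since R \<ge> 1 and \<theta> \<ge> 0, the factor
      \<open>R powr \<theta>\<close> is at least 1.\<close>
    have "1 * X powr (3/2) \<le> R powr \<theta> * X powr (3/2 + \<epsilon>)"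
      using X R1 \<epsilon> \<theta> by (intro mult_mono powr_mono) (auto simp: admissible_def ge_one_powr_ge_zero)
    then show "X powr (3/2) \<le> R powr \<theta> * X powr (3/2 + \<epsilon>)" by simp
  qed (use K in \<open>simp add: C_def\<close>)
  finally show "\<bar>real (det_count r X)
      - 16 / zeta 2 * (real (divisor_sum (nat \<bar>r\<bar>)) / real_of_int \<bar>r\<bar>) * X\<^sup>2\<bar>
      \<le> (672 * K + 86 * K ^ 3) * (real_of_int \<bar>r\<bar> powr \<theta> * X powr (3/2 + \<epsilon>))"
    using det_count_approx[OF X r] unfolding R_def C_def by linarith
qed

end
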